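(* Let $T>0$, $\nu>0$, $f\in L^2_{\mathrm{per}}$, let $\mu,\tilde\mu\ge 0$ be the nudging parameters, and let $K,M\in\mathbb{N}$. Let $u$ be the $2\pi$-periodic solution on $[0,T]$ of the heat equation $$u_t=\nu u_{xx}+f,\qquad u(0)=u_0,$$ with initial data $u_0$ given by a trigonometric polynomial of degree $K$. Let $(v^n,\tilde v^n)_{n\ge1}$ be the back-and-forth nudging sequence defined on $[0,T]$ by $$v^n_t=\nu v^n_{xx}+\mu P_M(u-v^n)+f,\qquad v^n(0)=\tilde v^{n-1}(0),$$ $$\tilde v^n_t=\nu \tilde v^n_{xx}-\tilde\mu P_M(u-\tilde v^n)+f,\qquad \tilde v^n(T)=v^n(T),$$ for $n=1,2,\dots$, initialized with $v^1(0)=\tilde v^0(0)=v_0$, where $v_0$ is a trigonometric polynomial of degree $K$. Then $$\lim_{n\to\infty}\|v^n(0)-u_0\|_{L^2_{\mathrm{per}}}=\|Q_M(v_0-u_0)\|_{L^2_{\mathrm{per}}}.$$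
   Context: $L^2_{\mathrm{per}}$ is the space of $2\pi$-periodic functions on $\mathbb{R}$ that are square-integrable over a period, with norm $\|g\|_{L^2_{\mathrm{per}}}=\left(\int_0^{2\pi}|g|^2\,dx\right)^{1/2}$. A trigonometric polynomial of degree $K$ is a function $\sum_{|k|\le K}c_k e^{ikx}$ whose highest frequency is $K$. $P_M$ is the projection of $L^2_{\mathrm{per}}$ onto the Fourier modes $e^{ikx}$ with $|k|\le M$, and $Q_M=I-P_M$. All equations are posed with $2\pi$-periodic boundary conditions in $x$, and solutions of the heat equation take values in $L^2_{\mathrm{per}}$ for $t\in[0,T]$. The equation for $\tilde v^n$ is solved backward in time from the terminal condition at $t=T$. Standing assumption: existence and uniqueness of solutions to the forward ($v^n$) and backward ($\tilde v^n$) equations.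
   Formalization: The formal theorem additionally assumes that at least one of the nudging parameters μ, μ̃ is positive; for μ = μ̃ = 0 the claim fails, since then v^n(0) = v_0 for all n (e.g. K = 0, u_0 = 1, v_0 = 2). *)

theory Defs
  imports "HOL-Analysis.Analysis"
begin

text \<open>Elements of \<open>L\<^sup>2\<^sub>p\<^sub>e\<^sub>r\<close> are represented by functions; equality in that space is
  equality almost everywhere.  Scalars are complex, which includes the real-valued case.\<close>

definition L2per :: "(real \<Rightarrow> complex) set" where
  "L2per = {g. (\<forall>x. g (x + 2 * pi) = g x) \<and> g \<in> borel_measurable lebesgue \<and>
               integrable (lebesgue_on {0..2 * pi}) (\<lambda>x. (cmod (g x))\<^sup>2)}"

definition L2per_norm :: "(real \<Rightarrow> complex) \<Rightarrow> real" where
  "L2per_norm g = sqrt (\<integral>x. (cmod (g x))\<^sup>2 \<partial>lebesgue_on {0..2 * pi})"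

definition fourier_coeff :: "(real \<Rightarrow> complex) \<Rightarrow> int \<Rightarrow> complex" where
  "fourier_coeff g k =
     (\<integral>x. g x * cis (- (of_int k * x)) \<partial>lebesgue_on {0..2 * pi}) / of_real (2 * pi)"

definition proj_low :: "nat \<Rightarrow> (real \<Rightarrow> complex) \<Rightarrow> real \<Rightarrow> complex" where
  "proj_low M g x = (\<Sum>k\<in>{- int M..int M}. fourier_coeff g k * cis (of_int k * x))"

definition proj_high :: "nat \<Rightarrow> (real \<Rightarrow> complex) \<Rightarrow> real \<Rightarrow> complex" where
  "proj_high M g x = g x - proj_low M g x"

text \<open>The degree is exactly \<open>K\<close>; every constant function, including zero, has degree \<open>0\<close>.\<close>

definition trig_poly_degree :: "nat \<Rightarrow> (real \<Rightarrow> complex) \<Rightarrow> bool" where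
  "trig_poly_degree K g \<longleftrightarrow>
     (\<exists>c :: int \<Rightarrow> complex.
        (K = 0 \<or> c (int K) \<noteq> 0 \<or> c (- int K) \<noteq> 0) \<and>
        g = (\<lambda>x. \<Sum>k\<in>{- int K..int K}. c k * cis (of_int k * x)))"

definition smooth_periodic :: "(real \<Rightarrow> real) \<Rightarrow> bool" where
  "smooth_periodic \<phi> \<longleftrightarrow>
     (\<forall>x. \<phi> (x + 2 * pi) = \<phi> x) \<and> (\<forall>n x. (deriv ^^ n) \<phi> field_differentiable at x)"

text \<open>\<open>h\<close> is the second derivative of \<open>g\<close> in the sense of periodic distributions.\<close>

definition weak_second_deriv :: "(real \<Rightarrow> complex) \<Rightarrow> (real \<Rightarrow> complex) \<Rightarrow> bool" where
  "weak_second_deriv g h \<longleftrightarrow>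
     (\<forall>\<phi>. smooth_periodic \<phi> \<longrightarrow>
        (\<integral>x. g x * of_real (deriv (deriv \<phi>) x) \<partial>lebesgue_on {0..2 * pi}) =
        (\<integral>x. h x * of_real (\<phi> x) \<partial>lebesgue_on {0..2 * pi}))"

definition L2per_continuous_on :: "real set \<Rightarrow> (real \<Rightarrow> real \<Rightarrow> complex) \<Rightarrow> bool" where
  "L2per_continuous_on S w \<longleftrightarrow>
     (\<forall>t\<in>S. ((\<lambda>s. L2per_norm (\<lambda>x. w s x - w t x)) \<longlongrightarrow> 0) (at t within S))"

definition has_L2per_time_deriv ::
    "(real \<Rightarrow> real \<Rightarrow> complex) \<Rightarrow> (real \<Rightarrow> complex) \<Rightarrow> real \<Rightarrow> bool" where
  "has_L2per_time_deriv w w\<^sub>t t \<longleftrightarrow>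
     ((\<lambda>s. L2per_norm (\<lambda>x. (w s x - w t x) / of_real (s - t) - w\<^sub>t x)) \<longlongrightarrow> 0) (at t)"

text \<open>\<open>w\<close> solves \<open>w\<^sub>t = \<nu> w\<^sub>x\<^sub>x + F\<close> on \<open>[0, T]\<close> as an \<open>L\<^sup>2\<^sub>p\<^sub>e\<^sub>r\<close>-valued function: continuous on
  \<open>[0, T]\<close>, and differentiable with the equation holding in \<open>L\<^sup>2\<^sub>p\<^sub>e\<^sub>r\<close> on the open interval.
  Initial or terminal conditions are imposed separately, so this covers both time directions.\<close>

definition heat_solution ::
    "real \<Rightarrow> real \<Rightarrow> (real \<Rightarrow> real \<Rightarrow> complex) \<Rightarrow> (real \<Rightarrow> real \<Rightarrow> complex) \<Rightarrow> bool" where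
  "heat_solution T \<nu> F w \<longleftrightarrow>
     (\<forall>t\<in>{0..T}. w t \<in> L2per) \<and>
     L2per_continuous_on {0..T} w \<and>
     (\<forall>t\<in>{0<..<T}. \<exists>w\<^sub>t\<in>L2per. \<exists>w\<^sub>x\<^sub>x\<in>L2per.
        has_L2per_time_deriv w w\<^sub>t t \<and>
        weak_second_deriv (w t) w\<^sub>x\<^sub>x \<and>
        (AE x in lebesgue. w\<^sub>t x = of_real \<nu> * w\<^sub>x\<^sub>x x + F t x))"

end

theory Submission
  imports Defs
begin

text \<open>Nudging by \<open>P\<^sub>M\<close> acts on each Fourier mode separately.  Both nudged equations have the form
  \<open>w\<^sub>t = \<nu> w\<^sub>x\<^sub>x + c P\<^sub>M (u - w) + f\<close>, with \<open>c = \<mu>\<close> forward and \<open>c = - \<mu>b\<close> backward, so the \<open>k\<close>-th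
  Fourier coefficient \<open>E\<close> of the error \<open>w - u\<close> satisfies \<open>E' = - (\<nu> k\<^sup>2 + c) E\<close> for \<open>\<bar>k\<bar> \<le> M\<close> and
  \<open>E' = - \<nu> k\<^sup>2 E\<close> otherwise (\<open>nudged_error_fourier_coeff\<close>).  Over one forward and one backward sweep the
  diffusion factors \<open>exp (- \<nu> k\<^sup>2 T)\<close> and \<open>exp (\<nu> k\<^sup>2 T)\<close> cancel: the error at time \<open>0\<close> is
  multiplied by \<open>exp (- (\<mu> + \<mu>b) T) < 1\<close> in the modes \<open>\<bar>k\<bar> \<le> M\<close> and is unchanged in all others.  Since
  the initial error has only the modes \<open>\<bar>k\<bar> \<le> K\<close>, so has the error at time \<open>0\<close> after every sweep, and
  its norm comes from a finite sum of squares in which the low modes decay and the high modes stay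
  fixed.

  Two points need analysis.  The solutions take values in \<open>L\<^sup>2\<close> and satisfy the equation only in a weak
  sense; since the coefficients are bounded by the norm (\<open>cmod_fourier_coeff_le\<close>), continuity and the
  time derivative pass to them, and testing with sines and cosines turns the second derivative into
  multiplication by \<open>- k\<^sup>2\<close>.  Conversely, reading off the norm of the error from its coefficients
  needs completeness of the trigonometric system (\<open>null_coeffs_imp_AE_zero\<close>): an integrable function
  whose coefficients all vanish is zero almost everywhere.  This follows from the Stone--Weierstrass
  theorem on the unit circle.\<close>

section \<open>Fourier coefficients and trigonometric sums\<close>

abbreviation period :: "real measure" where
  "period \<equiv> lebesgue_on {0..2 * pi}"

definition trig_sum :: "int set \<Rightarrow> (int \<Rightarrow> complex) \<Rightarrow> real \<Rightarrow> complex" where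
  "trig_sum A c x = (\<Sum>k\<in>A. c k * cis (of_int k * x))"

lemma measure_period: "measure period {0..2 * pi} = 2 * pi"
  by (simp add: measure_restrict_space)

lemma finite_measure_period: "finite_measure period"
  by (rule finite_measureI) (simp add: emeasure_restrict_space)

lemma integrable_period_const [simp]: "integrable period (\<lambda>x. c :: 'b::{banach,second_countable_topology})"
  using finite_measure.integrable_const[OF finite_measure_period] .

lemma continuous_imp_measurable_period:
  fixes \<phi> :: "real \<Rightarrow> 'b::euclidean_space"
  assumes "continuous_on UNIV \<phi>"
  shows "\<phi> \<in> borel_measurable period"
  by (meson assms continuous_imp_measurable_on_sets_lebesgue continuous_on_subset
      lmeasurable_interval(1) fmeasurableD subset_UNIV)

lemma integrable_mult_continuous:
  assumes "integrable period g" "continuous_on UNIV \<phi>" "\<And>x. norm (\<phi> x) \<le> 1"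
  shows "integrable period (\<lambda>x. g x * \<phi> x :: complex)"
proof (rule Bochner_Integration.integrable_bound[OF assms(1)])
  show "(\<lambda>x. g x * \<phi> x) \<in> borel_measurable period"
    using assms(1) continuous_imp_measurable_period[OF assms(2)] by measurable
  show "AE x in period. norm (g x * \<phi> x) \<le> norm (g x)"
    using mult_left_le[OF assms(3) norm_ge_zero] by (auto simp: norm_mult)
qed

lemma continuous_on_cis_linear: "continuous_on UNIV (\<lambda>x. cis (a * x))"
  by (auto simp: cis_conv_exp intro!: continuous_intros)

lemma integrable_mult_cis:
  assumes "integrable period g"
  shows "integrable period (\<lambda>x. g x * cis (a * x))"
  using integrable_mult_continuous[OF assms continuous_on_cis_linear[of a]] by simp

lemma integrable_mult_cis_minus:
  assumes "integrable period g"
  shows "integrable period (\<lambda>x. g x * cis (- (a * x)))"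
  using integrable_mult_cis[OF assms, of "-a"] by simp

lemma integrable_cis: "integrable period (\<lambda>x. cis (a * x))"
  using integrable_mult_cis[of "\<lambda>_. 1" a] by simp

lemma integrable_trig_sum: "integrable period (trig_sum A c)"
  unfolding trig_sum_def using integrable_cis by (auto intro!: Bochner_Integration.integrable_sum)

lemma fourier_coeff_add:
  assumes "integrable period g" "integrable period h"
  shows "fourier_coeff (\<lambda>x. g x + h x) k = fourier_coeff g k + fourier_coeff h k"
  using integrable_mult_cis_minus[OF assms(1)] integrable_mult_cis_minus[OF assms(2)]
  by (simp add: fourier_coeff_def ring_distribs add_divide_distrib)

lemma fourier_coeff_diff:
  assumes "integrable period g" "integrable period h"
  shows "fourier_coeff (\<lambda>x. g x - h x) k = fourier_coeff g k - fourier_coeff h k"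
  using integrable_mult_cis_minus[OF assms(1)] integrable_mult_cis_minus[OF assms(2)]
  by (simp add: fourier_coeff_def ring_distribs diff_divide_distrib)

lemma fourier_coeff_cmult: "fourier_coeff (\<lambda>x. c * g x) k = c * fourier_coeff g k"
  by (simp add: fourier_coeff_def mult.assoc)

lemma AE_period: "AE x in lebesgue. P x \<Longrightarrow> AE x in period. P x"
  by (subst AE_restrict_space_iff) auto

lemma fourier_coeff_cong_AE:
  assumes "integrable period g" "integrable period h" "AE x in lebesgue. g x = h x"
  shows "fourier_coeff g k = fourier_coeff h k"
  unfolding fourier_coeff_def
  using integrable_mult_cis_minus[OF assms(1)] integrable_mult_cis_minus[OF assms(2)] AE_period[OF assms(3)]
  by (intro arg_cong2[where f="(/)"] integral_cong_AE borel_measurable_integrable) auto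

lemma integral_cis_period:
  "(\<integral>x. cis (of_int j * x) \<partial>period) = (if j = 0 then of_real (2 * pi) else 0)"
proof (cases "j = 0")
  case True
  then show ?thesis by (simp add: measure_period scaleR_conv_of_real)
next
  case False
  have deriv: "((\<lambda>z. exp (\<i> * of_int j * z) / (\<i> * of_int j)) has_field_derivative
      exp (\<i> * of_int j * z)) (at z)" for z
    using False by (auto intro!: derivative_eq_intros)
  have "((\<lambda>x. cis (of_int j * x)) has_integral
     (cis (of_int j * (2*pi)) / (\<i> * of_int j) - cis (of_int j * 0) / (\<i> * of_int j))) {0..2*pi}"
  proof (rule fundamental_theorem_of_calculus)
    show "((\<lambda>x. cis (of_int j * x) / (\<i> * of_int j)) has_vector_derivative cis (of_int j * x))
        (at x within {0..2*pi})" for x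
      using has_vector_derivative_real_field[OF deriv] by (simp add: cis_conv_exp mult.assoc)
  qed simp
  moreover have "cis (of_int j * (2*pi)) = 1"
    by (metis cis_multiple_2pi Ints_of_int mult.commute mult.left_commute mult.assoc)
  ultimately have "integral {0..2*pi} (\<lambda>x. cis (of_int j * x)) = 0"
    by (simp add: integral_unique)
  then show ?thesis using False integrable_cis by (simp add: lebesgue_integral_eq_integral)
qed

text \<open>Orthogonality of the exponentials over a period: only the term \<open>j = k\<close> survives.\<close>
lemma fourier_coeff_trig_sum:
  assumes "finite A"
  shows "fourier_coeff (trig_sum A c) k = (if k \<in> A then c k else 0)"
proof -
  have "(\<integral>x. trig_sum A c x * cis (- (of_int k * x)) \<partial>period)
      = (\<integral>x. (\<Sum>j\<in>A. c j * cis (of_int (j - k) * x)) \<partial>period)"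
    by (simp add: trig_sum_def sum_distrib_right mult.assoc cis_mult ring_distribs)
  also have "\<dots> = (\<Sum>j\<in>A. c j * (\<integral>x. cis (of_int (j - k) * x) \<partial>period))"
    by (subst Bochner_Integration.integral_sum)
       (auto intro!: integrable_cis integrable_mult_right simp del: of_int_diff)
  also have "\<dots> = (\<Sum>j\<in>A. if j = k then c j * of_real (2 * pi) else 0)"
    unfolding integral_cis_period by (intro sum.cong) auto
  finally show ?thesis using assms by (simp add: fourier_coeff_def)
qed

text \<open>Writing \<open>\<bar>p\<bar>\<^sup>2 = p \<cdot> cnj p\<close> and expanding only the conjugate factor leaves the Fourier coefficients
  of \<open>p\<close>, so no double sum is needed.\<close>
lemma L2per_norm_trig_sum:
  assumes "finite A"
  shows "L2per_norm (trig_sum A c) = sqrt (2 * pi * (\<Sum>k\<in>A. (cmod (c k))\<^sup>2))"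
proof -
  have "complex_of_real (\<integral>x. (cmod (trig_sum A c x))\<^sup>2 \<partial>period)
      = (\<integral>x. complex_of_real ((cmod (trig_sum A c x))\<^sup>2) \<partial>period)"
    by (rule integral_complex_of_real[symmetric])
  also have "\<dots> = (\<integral>x. (\<Sum>k\<in>A. cnj (c k) * (trig_sum A c x * cis (- (of_int k * x)))) \<partial>period)"
    unfolding complex_norm_square
    by (intro Bochner_Integration.integral_cong)
       (simp_all add: trig_sum_def sum_distrib_left cis_cnj mult_ac)
  also have "\<dots> = (\<Sum>k\<in>A. cnj (c k) * (\<integral>x. trig_sum A c x * cis (- (of_int k * x)) \<partial>period))"
    by (subst Bochner_Integration.integral_sum)
       (auto intro!: integrable_mult_cis_minus integrable_mult_right integrable_trig_sum)
  also have "\<dots> = (\<Sum>k\<in>A. cnj (c k) * (of_real (2 * pi) * fourier_coeff (trig_sum A c) k))"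
    by (simp add: fourier_coeff_def)
  also have "\<dots> = (\<Sum>k\<in>A. complex_of_real (2 * pi * (cmod (c k))\<^sup>2))"
    using assms by (intro sum.cong)
      (simp_all add: fourier_coeff_trig_sum complex_norm_square mult_ac del: of_real_power)
  also have "\<dots> = complex_of_real (2 * pi * (\<Sum>k\<in>A. (cmod (c k))\<^sup>2))"
    by (simp add: sum_distrib_left)
  finally show ?thesis unfolding L2per_norm_def of_real_eq_iff by simp
qed

section \<open>Completeness of the trigonometric system\<close>

definition null_coeffs :: "(real \<Rightarrow> complex) \<Rightarrow> bool" where
  "null_coeffs h \<longleftrightarrow> integrable period h \<and> (\<forall>k. fourier_coeff h k = 0)"

lemma null_coeffs_integral_zero:
  assumes "null_coeffs h" shows "(\<integral>x. h x \<partial>period) = 0"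
proof -
  have "fourier_coeff h 0 = 0" using assms by (simp add: null_coeffs_def)
  then show ?thesis by (simp add: fourier_coeff_def)
qed

lemma null_coeffs_add:
  assumes "null_coeffs h1" "null_coeffs h2"
  shows "null_coeffs (\<lambda>x. h1 x + h2 x)"
  using assms by (simp add: null_coeffs_def fourier_coeff_add)

lemma null_coeffs_cmult:
  assumes "null_coeffs h"
  shows "null_coeffs (\<lambda>x. c * h x)"
  using assms by (simp add: null_coeffs_def fourier_coeff_cmult)

lemma null_coeffs_mult_cis:
  assumes "null_coeffs h"
  shows "null_coeffs (\<lambda>x. cis (of_int j * x) * h x)"
proof -
  have int: "integrable period h" using assms by (simp add: null_coeffs_def)
  have "fourier_coeff (\<lambda>x. cis (of_int j * x) * h x) k = fourier_coeff h (k - j)" for k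
  proof -
    have "cis (of_int j * x) * h x * cis (- (of_int k * x)) = h x * cis (- (of_int (k - j) * x))" for x
    proof -
      have "cis (of_int j * x) * cis (- (of_int k * x)) = cis (- (of_int (k - j) * x))"
        by (simp add: cis_mult algebra_simps)
      then show ?thesis by (simp add: mult_ac)
    qed
    then show ?thesis unfolding fourier_coeff_def by (simp only:)
  qed
  then show ?thesis
    using assms integrable_mult_cis[OF int, of "of_int j"] by (simp add: null_coeffs_def mult.commute)
qed

text \<open>The functions with vanishing coefficients form a module over the polynomials in the real and
  imaginary part of \<open>cis x\<close>.  In this form, products of polynomials cost nothing in the induction:
  they are two successive multiplications.  A linear function of \<open>cis x\<close> is a combination of
  \<open>cis x\<close> and \<open>cis (- x)\<close>, and multiplication by either shifts the coefficients.\<close>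
lemma null_coeffs_mult_polynomial:
  assumes "real_polynomial_function p" "null_coeffs h"
  shows "null_coeffs (\<lambda>x. of_real (p (cis x)) * h x)"
  using assms
proof (induction arbitrary: h rule: real_polynomial_function.induct)
  case (linear p)
  \<comment> \<open>This is \<open>p 1 * cos x + p \<i> * sin x\<close> in terms of exponentials.\<close>
  have p: "of_real (p (cis x)) = (of_real (p 1) - \<i> * of_real (p \<i>)) / 2 * cis (of_int 1 * x)
      + (of_real (p 1) + \<i> * of_real (p \<i>)) / 2 * cis (of_int (- 1) * x)" for x
  proof -
    have "p (cis x) = p (cos x *\<^sub>R 1 + sin x *\<^sub>R \<i>)"
      by (rule arg_cong[where f=p]) (simp add: complex_eq_iff)
    also have "\<dots> = cos x * p 1 + sin x * p \<i>"
      using linear.hyps by (simp add: linear_add linear_cmul bounded_linear.linear)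
    finally show ?thesis by (simp add: complex_eq_iff field_simps)
  qed
  have "null_coeffs (\<lambda>x. (of_real (p 1) - \<i> * of_real (p \<i>)) / 2 * (cis (of_int 1 * x) * h x)
      + (of_real (p 1) + \<i> * of_real (p \<i>)) / 2 * (cis (of_int (- 1) * x) * h x))"
    by (intro null_coeffs_add null_coeffs_cmult null_coeffs_mult_cis linear.prems)
  then show ?case unfolding p by (simp only: ring_distribs mult.assoc)
next
  case (const c)
  then show ?case by (rule null_coeffs_cmult)
next
  case (add f g)
  then show ?case using null_coeffs_add[OF add.IH(1) add.IH(2), of h h] by (simp add: ring_distribs)
next
  case (mult f g)
  then show ?case using mult.IH(1)[OF mult.IH(2), of h] by (simp add: mult.assoc)
qed

text \<open>By Stone--Weierstrass, \<open>\<phi>\<close> is on the unit circle a uniform limit of polynomials, against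
  each of which \<open>h\<close> integrates to zero.\<close>
lemma null_coeffs_integral_continuous:
  fixes \<phi> :: "complex \<Rightarrow> real"
  assumes h: "null_coeffs h" and \<phi>: "continuous_on UNIV \<phi>" and bd: "\<And>z. \<bar>\<phi> z\<bar> \<le> 1"
  shows "(\<integral>x. h x * of_real (\<phi> (cis x)) \<partial>period) = 0"
proof -
  have int: "integrable period h" using h by (simp add: null_coeffs_def)
  have cis: "continuous_on UNIV cis" using continuous_on_cis_linear[of 1] by simp
  have cont\<phi>: "continuous_on UNIV (\<lambda>x. complex_of_real (\<phi> (cis x)))"
    by (intro continuous_intros continuous_on_compose2[OF \<phi> cis]) auto
  have int\<phi>: "integrable period (\<lambda>x. h x * of_real (\<phi> (cis x)))"
    using bd by (intro integrable_mult_continuous int cont\<phi>) simp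
  have "cmod (\<integral>x. h x * of_real (\<phi> (cis x)) \<partial>period) \<le> e * (\<integral>x. cmod (h x) \<partial>period)" if "e > 0" for e
  proof -
    have "compact (sphere (0::complex) 1)" "continuous_on (sphere (0::complex) 1) \<phi>"
      using \<phi> continuous_on_subset by auto
    then obtain p where p: "real_polynomial_function p"
      and close: "\<And>z. z \<in> sphere 0 1 \<Longrightarrow> \<bar>\<phi> z - p z\<bar> < e"
      using Stone_Weierstrass_real_polynomial_function \<open>e > 0\<close> by metis
    have nullp: "null_coeffs (\<lambda>x. h x * of_real (p (cis x)))"
      using null_coeffs_mult_polynomial[OF p h] by (simp add: mult.commute)
    then have intp: "integrable period (\<lambda>x. h x * of_real (p (cis x)))" by (simp add: null_coeffs_def)
    have "(\<integral>x. h x * of_real (\<phi> (cis x)) \<partial>period)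
        = (\<integral>x. h x * of_real (\<phi> (cis x)) - h x * of_real (p (cis x)) \<partial>period)"
      using null_coeffs_integral_zero[OF nullp] int\<phi> intp by simp
    also have "cmod \<dots> \<le> (\<integral>x. e * cmod (h x) \<partial>period)"
    proof (rule order_trans[OF integral_norm_bound], rule integral_mono)
      show "integrable period (\<lambda>x. cmod (h x * of_real (\<phi> (cis x)) - h x * of_real (p (cis x))))"
        using int\<phi> intp by simp
      show "integrable period (\<lambda>x. e * cmod (h x))" using int by simp
      show "cmod (h x * of_real (\<phi> (cis x)) - h x * of_real (p (cis x))) \<le> e * cmod (h x)" for x
      proof -
        have "cmod (h x * of_real (\<phi> (cis x)) - h x * of_real (p (cis x)))
            = cmod (h x) * \<bar>\<phi> (cis x) - p (cis x)\<bar>"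
          by (metis (no_types) norm_mult norm_of_real of_real_diff right_diff_distrib)
        also have "\<dots> \<le> cmod (h x) * e"
          using close[of "cis x"] by (intro mult_left_mono) auto
        finally show ?thesis by (simp add: mult.commute)
      qed
    qed
    finally show ?thesis by simp
  qed
  then have "cmod (\<integral>x. h x * of_real (\<phi> (cis x)) \<partial>period) \<le> 0"
  proof -
    assume le: "\<And>e. 0 < e \<Longrightarrow> cmod (\<integral>x. h x * of_real (\<phi> (cis x)) \<partial>period) \<le> e * (\<integral>x. cmod (h x) \<partial>period)"
    have "((\<lambda>e. e * (\<integral>x. cmod (h x) \<partial>period)) \<longlongrightarrow> 0 * (\<integral>x. cmod (h x) \<partial>period)) (at_right 0)"
      by (intro tendsto_intros)
    then show ?thesis using le
      by (intro tendsto_lowerbound) (auto simp: eventually_at_right_less eventually_at_filter)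
  qed
  then show ?thesis by simp
qed

text \<open>The ends \<open>0\<close> and \<open>2 * pi\<close> are the only two points of the period that \<open>cis\<close> identifies, so for
  \<open>G\<close> in the open period the preimage in the period of \<open>cis ` G\<close> is \<open>G\<close> itself.\<close>
lemma cis_inj_open_period:
  assumes "x \<in> {0..2 * pi}" "y \<in> {0<..<2 * pi}" "cis x = cis y"
  shows "x = y"
proof -
  have "cis (x - y) = 1" using assms(3) by (simp flip: cis_divide)
  then have "cos (x - y) = 1" by (metis cis.sel(1) one_complex.sel(1))
  then obtain n :: int where n: "x - y = of_int n * 2 * pi" using cos_one_2pi_int by auto
  have "\<bar>of_int n * (2 * pi)\<bar> < 1 * (2 * pi)" using n assms(1,2) by auto
  then have "\<bar>of_int n\<bar> < (1::real)" by (simp add: abs_mult)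
  then have "n = 0" by linarith
  then show ?thesis using n by simp
qed

text \<open>The indicator of the compact set \<open>cis ` G\<close> is the pointwise limit of continuous
  functions on the circle that decrease linearly, ever more steeply, with the distance to it.\<close>
lemma null_coeffs_integral_compact:
  assumes h: "null_coeffs h" and G: "compact G" "G \<subseteq> {0<..<2 * pi}"
  shows "(\<integral>x. indicator G x *\<^sub>R h x \<partial>period) = 0"
proof (cases "G = {}")
  case False
  define C where "C = cis ` G"
  have C: "closed C" "C \<noteq> {}"
    using False G continuous_on_cis_linear[of 1] unfolding C_def
    by (auto intro!: compact_imp_closed compact_continuous_image intro: continuous_on_subset)
  have mem: "cis x \<in> C \<longleftrightarrow> x \<in> G" if "x \<in> {0..2*pi}" for x
    using cis_inj_open_period[OF that] G(2) unfolding C_def by blast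
  define \<phi> where "\<phi> n z = max 0 (1 - real n * infdist z C)" for n z
  have int: "integrable period h" using h by (simp add: null_coeffs_def)
  have cont: "continuous_on UNIV (\<phi> n)" for n
    unfolding \<phi>_def by (intro continuous_intros)
  have bd: "\<bar>\<phi> n z\<bar> \<le> 1" for n z
    unfolding \<phi>_def using infdist_nonneg[of z C] by (auto simp: max_def)
  have cis: "continuous_on UNIV cis" using continuous_on_cis_linear[of 1] by simp
  have mem_meas: "indicator G \<in> borel_measurable (period :: real measure)"
  proof (rule borel_measurable_indicator)
    have "G \<subseteq> {0..2*pi}" using G(2) by fastforce
    then show "G \<in> sets period"
      using fmeasurableD[OF lmeasurable_compact[OF G(1)]]
      by (auto simp: sets_restrict_space intro!: image_eqI[of _ _ G])
  qed
  have "(\<lambda>n. \<integral>x. h x * of_real (\<phi> n (cis x)) \<partial>period) \<longlonglongrightarrow> (\<integral>x. indicator G x *\<^sub>R h x \<partial>period)"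
  proof (rule integral_dominated_convergence[where w="\<lambda>x. cmod (h x)"])
    show "(\<lambda>x. indicator G x *\<^sub>R h x) \<in> borel_measurable period"
      using mem_meas int by measurable
    show "(\<lambda>x. h x * of_real (\<phi> n (cis x))) \<in> borel_measurable period" for n
      using int continuous_imp_measurable_period[OF continuous_on_compose2[OF cont[of n] cis]]
      by measurable
    show "integrable period (\<lambda>x. cmod (h x))" using int by simp
    show "AE x in period. cmod (h x * of_real (\<phi> n (cis x))) \<le> cmod (h x)" for n
      using mult_left_le[OF bd norm_ge_zero] by (auto simp: norm_mult)
    show "AE x in period. (\<lambda>n. h x * of_real (\<phi> n (cis x))) \<longlonglongrightarrow> indicator G x *\<^sub>R h x"
    proof (rule AE_I2)
      fix x assume "x \<in> space period"
      then have x: "x \<in> {0..2*pi}" by simp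
      have "(\<lambda>n. \<phi> n (cis x)) \<longlonglongrightarrow> indicator G x"
      proof (cases "x \<in> G")
        case True
        then show ?thesis using mem[OF x] by (simp add: \<phi>_def)
      next
        case False
        then have pos: "infdist (cis x) C > 0"
          using C mem[OF x] by (metis in_closed_iff_infdist_zero infdist_nonneg order_le_less)
        obtain N :: nat where N: "real N * infdist (cis x) C > 1"
          using reals_Archimedean3[OF pos] by blast
        have "\<phi> n (cis x) = 0" if "n \<ge> N" for n
        proof -
          have "real N * infdist (cis x) C \<le> real n * infdist (cis x) C"
            using that pos by (intro mult_right_mono) auto
          then show ?thesis using N by (simp add: \<phi>_def)
        qed
        then have "eventually (\<lambda>n. \<phi> n (cis x) = 0) sequentially"
          by (auto simp: eventually_sequentially)
        then show ?thesis using False by (simp add: tendsto_eventually)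
      qed
      then have "(\<lambda>n. h x * of_real (\<phi> n (cis x))) \<longlonglongrightarrow> h x * of_real (indicator G x)"
        by (intro tendsto_intros)
      then show "(\<lambda>n. h x * of_real (\<phi> n (cis x))) \<longlonglongrightarrow> indicator G x *\<^sub>R h x"
        by (simp add: scaleR_conv_of_real mult.commute)
    qed
  qed
  then show ?thesis
    using null_coeffs_integral_continuous[OF h cont bd] by (simp add: LIMSEQ_const_iff)
qed simp

text \<open>Up to a null set a measurable subset of the period is an increasing union of compact subsets
  of the open period, so the integral of \<open>h\<close> over every measurable set vanishes.\<close>
theorem null_coeffs_imp_AE_zero:
  assumes h: "null_coeffs h"
  shows "AE x in period. h x = 0"
proof (rule sigma_finite_measure.density_zero)
  show "sigma_finite_measure period"
    using finite_measure_period finite_measure.axioms(1) by blast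
  show int: "integrable period h" using h by (simp add: null_coeffs_def)
  fix A assume "A \<in> sets period"
  then have A: "A \<in> sets lebesgue" "A \<subseteq> {0..2*pi}" by (auto simp: sets_restrict_space)
  have "A \<inter> {0<..<2*pi} \<in> sets lebesgue" using A(1) by auto
  then obtain C N where C: "fsigma C" and N: "N \<in> null_sets lebesgue" and CN: "C \<union> N = A \<inter> {0<..<2*pi}"
    using lebesgue_set_almost_fsigma by metis
  obtain F :: "nat \<Rightarrow> real set" where F: "\<And>n. closed (F n)" "C = (\<Union>n. F n)"
    using C by (auto elim!: fsigma.cases)
  define G where "G n = (\<Union>i\<le>n. F i)" for n
  have sub: "G n \<subseteq> {0<..<2*pi}" for n using CN F(2) unfolding G_def by blast
  have comp: "compact (G n)" for n
    unfolding compact_eq_bounded_closed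
    using bounded_subset[OF _ sub[of n]] F(1) by (auto simp: G_def)
  have meas: "S \<in> sets period" if "S \<in> sets lebesgue" "S \<subseteq> {0..2*pi}" for S
    using that by (auto simp: sets_restrict_space intro!: image_eqI[of _ _ S])
  have measG: "G n \<in> sets period" for n
    using comp[of n] sub[of n] by (intro meas) (auto intro!: fmeasurableD lmeasurable_compact)
  have UG: "C = (\<Union>n. G n)" unfolding F(2) G_def by auto
  then have measC: "C \<in> sets period" using measG by auto
  have "(\<lambda>n. \<integral>x. indicator (G n) x *\<^sub>R h x \<partial>period) \<longlonglongrightarrow> (\<integral>x. indicator C x *\<^sub>R h x \<partial>period)"
  proof (rule integral_dominated_convergence[where w="\<lambda>x. cmod (h x)"])
    show "(\<lambda>x. indicator C x *\<^sub>R h x) \<in> borel_measurable period" using int measC by measurable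
    show "(\<lambda>x. indicator (G n) x *\<^sub>R h x) \<in> borel_measurable period" for n using int measG by measurable
    show "integrable period (\<lambda>x. cmod (h x))" using int by simp
    show "AE x in period. cmod (indicator (G n) x *\<^sub>R h x) \<le> cmod (h x)" for n
      by (auto simp: indicator_def)
    show "AE x in period. (\<lambda>n. indicator (G n) x *\<^sub>R h x) \<longlonglongrightarrow> indicator C x *\<^sub>R h x"
    proof (rule AE_I2, intro tendsto_intros)
      have "incseq G" unfolding G_def incseq_def by (intro allI impI UN_mono) auto
      then show "(\<lambda>n. indicat_real (G n) x) \<longlonglongrightarrow> indicator C x" for x
        unfolding UG by (rule LIMSEQ_indicator_incseq)
    qed
  qed
  then have zero: "(\<integral>x. indicator C x *\<^sub>R h x \<partial>period) = 0"
    using null_coeffs_integral_compact[OF h comp sub] by (simp add: LIMSEQ_const_iff)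
  \<comment> \<open>\<open>A\<close> and \<open>C\<close> differ only inside \<open>N\<close> and the two ends of the period.\<close>
  have "{0, 2*pi} \<in> null_sets lebesgue" by (auto simp: null_sets_completionI finite_imp_null_set_lborel)
  then have "N \<union> {0, 2*pi} \<in> null_sets lebesgue" using N by (rule null_sets.Un[rotated])
  then have "AE x in lebesgue. x \<notin> N \<union> {0, 2*pi}" by (rule AE_not_in)
  then have "AE x in period. x \<notin> N \<union> {0, 2*pi}" by (rule AE_period)
  then have "AE x in period. indicator A x *\<^sub>R h x = indicator C x *\<^sub>R h x"
    using AE_space
  proof eventually_elim
    case (elim x)
    then have "x \<in> A \<longleftrightarrow> x \<in> C" using CN A(2) by auto
    then show ?case by (simp add: indicator_def)
  qed
  then show "set_lebesgue_integral period A h = 0"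
    unfolding set_lebesgue_integral_def using zero int \<open>A \<in> sets period\<close> measC
    by (subst integral_cong_AE[where g="\<lambda>x. indicator C x *\<^sub>R h x"]) auto
qed

section \<open>Square-integrable periodic functions\<close>

lemma L2per_measurable: "g \<in> L2per \<Longrightarrow> g \<in> borel_measurable period"
  by (simp add: L2per_def measurable_restrict_space1)

lemma L2per_square_integrable: "g \<in> L2per \<Longrightarrow> integrable period (\<lambda>x. (cmod (g x))\<^sup>2)"
  by (simp add: L2per_def)

lemma L2per_integrable:
  assumes "g \<in> L2per" shows "integrable period g"
proof (rule Bochner_Integration.integrable_bound)
  show "integrable period (\<lambda>x. 1 + (cmod (g x))\<^sup>2)" using L2per_square_integrable[OF assms] by simp
  show "g \<in> borel_measurable period" by (rule L2per_measurable[OF assms])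
  have "cmod z \<le> 1 + (cmod z)\<^sup>2" for z
    using norm_ge_zero[of z] zero_le_power2[of "cmod z - 1"] unfolding power2_diff power_one mult_1_right by linarith
  then show "AE x in period. cmod (g x) \<le> norm (1 + (cmod (g x))\<^sup>2)"
    by (intro AE_I2) (simp add: order_trans[OF _ abs_ge_self])
qed

lemma L2per_diff:
  assumes "g \<in> L2per" "h \<in> L2per"
  shows "(\<lambda>x. g x - h x) \<in> L2per"
proof -
  have "integrable period (\<lambda>x. (cmod (g x - h x))\<^sup>2)"
  proof (rule Bochner_Integration.integrable_bound)
    show "integrable period (\<lambda>x. 2 * (cmod (g x))\<^sup>2 + 2 * (cmod (h x))\<^sup>2)"
      using assms by (simp add: L2per_square_integrable)
    show "(\<lambda>x. (cmod (g x - h x))\<^sup>2) \<in> borel_measurable period"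
      using assms[THEN L2per_measurable] by measurable
    have "(cmod (a - b))\<^sup>2 \<le> 2 * (cmod a)\<^sup>2 + 2 * (cmod b)\<^sup>2" for a b
    proof -
      have "(cmod (a - b))\<^sup>2 \<le> (cmod a + cmod b)\<^sup>2"
        by (intro power_mono norm_triangle_ineq4) simp
      also have "\<dots> \<le> 2 * (cmod a)\<^sup>2 + 2 * (cmod b)\<^sup>2"
        using zero_le_power2[of "cmod a - cmod b"] by (simp add: power2_sum power2_diff)
      finally show ?thesis .
    qed
    then show "AE x in period. norm ((cmod (g x - h x))\<^sup>2) \<le> norm (2 * (cmod (g x))\<^sup>2 + 2 * (cmod (h x))\<^sup>2)"
      by (intro AE_I2) simp
  qed
  then show ?thesis using assms unfolding L2per_def by auto
qed

lemma L2per_cmult: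
  assumes "g \<in> L2per"
  shows "(\<lambda>x. c * g x) \<in> L2per"
  using assms unfolding L2per_def by (auto simp: norm_mult power_mult_distrib)

text \<open>This bound transfers limits in \<open>L\<^sup>2\<close> to Fourier coefficients.  It is the Cauchy--Schwarz inequality
  \<open>m\<^sup>2 \<le> 2 \<pi> S\<close> for the integral \<open>m\<close> of \<open>\<bar>g\<bar>\<close> and the integral \<open>S\<close> of \<open>\<bar>g\<bar>\<^sup>2\<close>, which
  says that the variance of \<open>\<bar>g\<bar>\<close> is nonnegative.\<close>
lemma cmod_fourier_coeff_le:
  assumes "g \<in> L2per"
  shows "cmod (fourier_coeff g k) \<le> L2per_norm g"
proof -
  define m where "m = (\<integral>x. cmod (g x) \<partial>period)"
  define S where "S = (\<integral>x. (cmod (g x))\<^sup>2 \<partial>period)"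
  have int: "integrable period (\<lambda>x. cmod (g x))" "integrable period (\<lambda>x. (cmod (g x))\<^sup>2)"
    using L2per_integrable[OF assms] L2per_square_integrable[OF assms] by simp_all
  \<comment> \<open>\<open>m / (2 * pi)\<close> is the mean of \<open>\<bar>g\<bar>\<close> over the period.\<close>
  have "0 \<le> (\<integral>x. (cmod (g x) - m / (2 * pi))\<^sup>2 \<partial>period)" by simp
  also have "\<dots> = (\<integral>x. (cmod (g x))\<^sup>2 + (m / (2 * pi))\<^sup>2 - m / pi * cmod (g x) \<partial>period)"
    by (simp add: power2_diff mult_ac)
  also have "\<dots> = S + (m / (2 * pi))\<^sup>2 * (2 * pi) - m / pi * m"
    using int by (simp add: m_def S_def measure_period)
  also have "\<dots> = S - m\<^sup>2 / (2 * pi)" by (simp add: field_simps power2_eq_square)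
  finally have "m\<^sup>2 / (2 * pi) \<le> S" by simp
  moreover have "(m / (2 * pi))\<^sup>2 \<le> m\<^sup>2 / (2 * pi)"
  proof -
    have "(m / (2 * pi))\<^sup>2 = m\<^sup>2 / (2 * pi) / (2 * pi)" by (simp add: power2_eq_square)
    also have "\<dots> \<le> m\<^sup>2 / (2 * pi) / 1"
      using pi_gt3 by (intro divide_left_mono) auto
    finally show ?thesis by simp
  qed
  moreover have "cmod (fourier_coeff g k) \<le> m / (2 * pi)"
  proof -
    have "cmod (\<integral>x. g x * cis (- (of_int k * x)) \<partial>period) \<le> m"
      unfolding m_def by (rule order_trans[OF integral_norm_bound]) (simp add: norm_mult)
    then show ?thesis by (simp add: fourier_coeff_def norm_divide divide_right_mono)
  qed
  ultimately have "(cmod (fourier_coeff g k))\<^sup>2 \<le> S"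
    by (meson norm_ge_zero order_trans power_mono)
  then show ?thesis unfolding L2per_norm_def S_def by (rule real_le_rsqrt)
qed

section \<open>The heat equation mode by mode\<close>

lemma deriv_cos_sin:
  "deriv (\<lambda>x::real. a * cos (k * x) + b * sin (k * x)) = (\<lambda>x. (k * b) * cos (k * x) + (- k * a) * sin (k * x))"
  by (rule ext, rule DERIV_imp_deriv) (auto intro!: derivative_eq_intros)

text \<open>Combinations of \<open>cos (k x)\<close> and \<open>sin (k x)\<close> are closed under differentiation, which is why the induction
  over the order of the derivative has to vary \<open>a\<close> and \<open>b\<close>.\<close>
lemma smooth_periodic_cos_sin:
  "smooth_periodic (\<lambda>x. a * cos (of_int k * x) + b * sin (of_int k * x))"
  unfolding smooth_periodic_def
proof (intro conjI allI)
  fix x :: real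
  have "cis (of_int k * (x + 2 * pi)) = cis (of_int k * x)"
  proof -
    have "cis (of_int k * (x + 2 * pi)) = cis (of_int k * x) * cis (2 * pi * of_int k)"
      by (simp add: cis_mult algebra_simps)
    then show ?thesis by simp
  qed
  then show "a * cos (of_int k * (x + 2 * pi)) + b * sin (of_int k * (x + 2 * pi))
      = a * cos (of_int k * x) + b * sin (of_int k * x)"
    by (simp add: complex_eq_iff)
next
  fix n and x :: real
  show "(deriv ^^ n) (\<lambda>x. a * cos (of_int k * x) + b * sin (of_int k * x)) field_differentiable at x"
  proof (induction n arbitrary: a b)
    case 0
    show ?case by (auto simp: field_differentiable_def intro!: exI derivative_eq_intros)
  next
    case (Suc n)
    show ?case
      using Suc.IH[of "of_int k * b" "- of_int k * a"]
      by (simp only: funpow_Suc_right deriv_cos_sin o_apply)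
  qed
qed

lemma weak_second_deriv_trig:
  assumes "weak_second_deriv g h"
  shows "(\<integral>x. h x * of_real (a * cos (of_int k * x) + b * sin (of_int k * x)) \<partial>period)
       = - (of_int k)\<^sup>2 * (\<integral>x. g x * of_real (a * cos (of_int k * x) + b * sin (of_int k * x)) \<partial>period)"
proof -
  let ?\<phi> = "\<lambda>x::real. a * cos (of_int k * x) + b * sin (of_int k * x)"
  have "(\<integral>x. h x * of_real (?\<phi> x) \<partial>period) = (\<integral>x. g x * of_real (deriv (deriv ?\<phi>) x) \<partial>period)"
    using assms smooth_periodic_cos_sin[of a k b] unfolding weak_second_deriv_def by simp
  also have "\<dots> = (\<integral>x. - (of_int k)\<^sup>2 * (g x * of_real (?\<phi> x)) \<partial>period)"
    unfolding deriv_cos_sin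
    by (intro Bochner_Integration.integral_cong) (simp_all add: algebra_simps power2_eq_square)
  finally show ?thesis by simp
qed

text \<open>The test functions are real, so the exponential \<open>cis (- k x)\<close> is tested through its real and
  imaginary part.\<close>
lemma fourier_coeff_weak_second_deriv:
  assumes wd: "weak_second_deriv g h" and int: "integrable period g" "integrable period h"
  shows "fourier_coeff h k = - (of_int k)\<^sup>2 * fourier_coeff g k"
proof -
  have split: "(\<integral>x. f x * cis (- (of_int k * x)) \<partial>period)
      = (\<integral>x. f x * of_real (1 * cos (of_int k * x) + 0 * sin (of_int k * x)) \<partial>period)
        - \<i> * (\<integral>x. f x * of_real (0 * cos (of_int k * x) + 1 * sin (of_int k * x)) \<partial>period)"
    if f: "integrable period f" for f
  proof -
    have "integrable period (\<lambda>x. f x * complex_of_real (cos (of_int k * x)))"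
      "integrable period (\<lambda>x. f x * complex_of_real (sin (of_int k * x)))"
      by (intro integrable_mult_continuous[OF f] continuous_intros; simp)+
    moreover have "f x * cis (- (of_int k * x)) = f x * of_real (cos (of_int k * x))
        - \<i> * (f x * of_real (sin (of_int k * x)))" for x
      by (simp add: complex_eq_iff algebra_simps)
    ultimately show ?thesis by simp
  qed
  show ?thesis
    unfolding fourier_coeff_def split[OF int(1)] split[OF int(2)] weak_second_deriv_trig[OF wd]
    by (simp add: algebra_simps diff_divide_distrib)
qed

lemma heat_solution_fourier_coeff_continuous:
  assumes "heat_solution T \<nu> F w"
  shows "continuous_on {0..T} (\<lambda>t. fourier_coeff (w t) k)"
  unfolding continuous_on_def
proof
  fix t assume t: "t \<in> {0..T}"
  have L2: "w s \<in> L2per" if "s \<in> {0..T}" for s using assms that by (simp add: heat_solution_def)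
  have "((\<lambda>s. fourier_coeff (w s) k - fourier_coeff (w t) k) \<longlongrightarrow> 0) (at t within {0..T})"
  proof (rule Lim_null_comparison)
    show "((\<lambda>s. L2per_norm (\<lambda>x. w s x - w t x)) \<longlongrightarrow> 0) (at t within {0..T})"
      using assms t by (simp add: heat_solution_def L2per_continuous_on_def)
    have "cmod (fourier_coeff (w s) k - fourier_coeff (w t) k) \<le> L2per_norm (\<lambda>x. w s x - w t x)"
      if "s \<in> {0..T}" for s
      using cmod_fourier_coeff_le[OF L2per_diff[OF L2[OF that] L2[OF t]], of k] L2[OF that] L2[OF t]
      by (simp add: fourier_coeff_diff L2per_integrable)
    then show "\<forall>\<^sub>F s in at t within {0..T}.
        cmod (fourier_coeff (w s) k - fourier_coeff (w t) k) \<le> L2per_norm (\<lambda>x. w s x - w t x)"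
      by (simp add: eventually_at_filter)
  qed
  then show "((\<lambda>s. fourier_coeff (w s) k) \<longlongrightarrow> fourier_coeff (w t) k) (at t within {0..T})"
    by (simp add: LIM_zero_iff)
qed

text \<open>The coefficient of the \<open>L\<^sup>2\<close> difference quotient is the difference quotient of the coefficient,
  so the limit of the former in norm gives the derivative of the latter.\<close>
lemma heat_solution_fourier_coeff_deriv:
  assumes sol: "heat_solution T \<nu> F w" and t: "t \<in> {0<..<T}" and F: "integrable period (F t)"
  shows "((\<lambda>s. fourier_coeff (w s) k) has_vector_derivative
     (- (of_real \<nu> * (of_int k)\<^sup>2) * fourier_coeff (w t) k + fourier_coeff (F t) k)) (at t)"
proof -
  have L2: "w s \<in> L2per" if "s \<in> {0..T}" for s using sol that by (simp add: heat_solution_def)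
  have t': "t \<in> {0..T}" using t by simp
  obtain wt wxx where w: "wt \<in> L2per" "wxx \<in> L2per" "has_L2per_time_deriv w wt t"
      "weak_second_deriv (w t) wxx" "AE x in lebesgue. wt x = of_real \<nu> * wxx x + F t x"
    using sol t unfolding heat_solution_def by blast
  have int: "integrable period wt" "integrable period wxx" "integrable period (w t)"
    using w(1,2) L2[OF t'] by (simp_all add: L2per_integrable)
  have "fourier_coeff wt k = fourier_coeff (\<lambda>x. of_real \<nu> * wxx x + F t x) k"
    using int F w(5) by (intro fourier_coeff_cong_AE) simp_all
  also have "\<dots> = - (of_real \<nu> * (of_int k)\<^sup>2) * fourier_coeff (w t) k + fourier_coeff (F t) k"
    using int F w(4)
    by (simp add: fourier_coeff_add fourier_coeff_cmult fourier_coeff_weak_second_deriv[OF w(4)])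
  finally have rhs: "fourier_coeff wt k = \<dots>" .
  have "((\<lambda>s. (fourier_coeff (w s) k - fourier_coeff (w t) k) / of_real (s - t) - fourier_coeff wt k) \<longlongrightarrow> 0) (at t)"
  proof (rule Lim_null_comparison)
    show "((\<lambda>s. L2per_norm (\<lambda>x. (w s x - w t x) / of_real (s - t) - wt x)) \<longlongrightarrow> 0) (at t)"
      using w(3) by (simp add: has_L2per_time_deriv_def)
    have bound: "cmod ((fourier_coeff (w s) k - fourier_coeff (w t) k) / of_real (s - t) - fourier_coeff wt k)
        \<le> L2per_norm (\<lambda>x. (w s x - w t x) / of_real (s - t) - wt x)"
      if "s \<in> {0<..<T}" for s
    proof -
      have s: "w s \<in> L2per" using that by (intro L2) simp
      have q: "(\<lambda>x. inverse (of_real (s - t)) * (w s x - w t x)) \<in> L2per"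
        by (intro L2per_cmult L2per_diff s L2 t')
      have "fourier_coeff (\<lambda>x. inverse (of_real (s - t)) * (w s x - w t x) - wt x) k
          = inverse (of_real (s - t)) * (fourier_coeff (w s) k - fourier_coeff (w t) k) - fourier_coeff wt k"
        using L2per_integrable[OF q] L2per_integrable[OF s] int
        by (simp only: fourier_coeff_diff fourier_coeff_cmult)
      then show ?thesis
        using cmod_fourier_coeff_le[OF L2per_diff[OF q w(1)], of k]
        by (simp add: divide_inverse mult.commute)
    qed
    have "\<forall>\<^sub>F s in at t. s \<in> {0<..<T}"
      using t by (intro eventually_at_in_open') auto
    then show "\<forall>\<^sub>F s in at t. cmod ((fourier_coeff (w s) k - fourier_coeff (w t) k) / of_real (s - t) - fourier_coeff wt k)
        \<le> L2per_norm (\<lambda>x. (w s x - w t x) / of_real (s - t) - wt x)"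
      by eventually_elim (rule bound)
  qed
  then have "((\<lambda>s. cmod ((fourier_coeff (w s) k - fourier_coeff (w t) k) / of_real (s - t) - fourier_coeff wt k)) \<longlongrightarrow> 0) (at t)"
    by (rule tendsto_norm_zero)
  moreover have "\<forall>\<^sub>F s in at t.
      cmod ((fourier_coeff (w s) k - fourier_coeff (w t) k) / of_real (s - t) - fourier_coeff wt k)
      = cmod (fourier_coeff (w s) k - fourier_coeff (w t) k - (s - t) *\<^sub>R fourier_coeff wt k) / norm (s - t)"
  proof -
    have "cmod (z / of_real r - y) = cmod (z - r *\<^sub>R y) / norm r" if "r \<noteq> 0" for z y r
    proof -
      have "z / of_real r - y = (z - r *\<^sub>R y) / of_real r"
        using that by (simp add: field_simps scaleR_conv_of_real)
      then show ?thesis by (simp add: norm_divide)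
    qed
    from this[of "s - t" for s] show ?thesis by (intro eventually_at_topological[THEN iffD2]) auto
  qed
  ultimately have "((\<lambda>s. cmod (fourier_coeff (w s) k - fourier_coeff (w t) k - (s - t) *\<^sub>R fourier_coeff wt k)
      / norm (s - t)) \<longlongrightarrow> 0) (at t)"
    by (rule Lim_transform_eventually)
  then show ?thesis
    unfolding rhs[symmetric] has_vector_derivative_def has_derivative_iff_norm
    by (simp add: bounded_linear_scaleR_left)
qed

text \<open>The product of \<open>E\<close> with the integrating factor \<open>exp (r t)\<close> is continuous on \<open>[0, T]\<close> and has
  derivative zero in the interior, hence is constant.\<close>
lemma linear_ode_endpoint:
  fixes E :: "real \<Rightarrow> complex" and r :: real
  assumes "T > 0" "continuous_on {0..T} E"
    and deriv: "\<And>t. t \<in> {0<..<T} \<Longrightarrow> (E has_vector_derivative (- of_real r * E t)) (at t)"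
  shows "E T = of_real (exp (- r * T)) * E 0"
proof -
  have "of_real (exp (r * T)) * E T = of_real (exp (r * 0)) * E 0"
  proof (rule has_derivative_zero_unique_strong_interval[where k="{0, T}" and a=0 and b=T])
    show "continuous_on {0..T} (\<lambda>t. of_real (exp (r * t)) * E t)"
      by (intro continuous_intros assms)
    fix t assume "t \<in> {0..T} - {0, T}"
    then have t: "t \<in> {0<..<T}" by auto
    have e: "((\<lambda>t. complex_of_real (exp (r * t))) has_vector_derivative of_real (r * exp (r * t))) (at t)"
      by (intro has_vector_derivative_of_real) (auto intro!: derivative_eq_intros)
    have "((\<lambda>t. of_real (exp (r * t)) * E t) has_vector_derivative 0) (at t)"
      using has_vector_derivative_mult[OF e deriv[OF t]] by (simp add: algebra_simps)
    then show "((\<lambda>t. of_real (exp (r * t)) * E t) has_derivative (\<lambda>h. 0)) (at t within {0..T})"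
      by (auto simp: has_vector_derivative_def intro: has_derivative_at_withinI)
  qed (use assms in auto)
  then have "of_real (exp (- r * T)) * (of_real (exp (r * T)) * E T) = of_real (exp (- r * T)) * E 0"
    by simp
  then show ?thesis by (simp flip: mult.assoc of_real_mult exp_add)
qed

lemma proj_low_eq_trig_sum: "proj_low M g = trig_sum {- int M..int M} (fourier_coeff g)"
  by (simp add: fun_eq_iff proj_low_def trig_sum_def)

text \<open>Both sweeps are instances: \<open>c = \<mu>\<close> for the forward equation, and \<open>c = - \<mu>b\<close> for the backward one,
  where the relation is later solved for the value at time \<open>0\<close>.\<close>
lemma nudged_error_fourier_coeff:
  assumes T: "T > 0" and f: "f \<in> L2per"
    and u: "heat_solution T \<nu> (\<lambda>t. f) u"
    and w: "heat_solution T \<nu> (\<lambda>t x. of_real c * proj_low M (\<lambda>y. u t y - w t y) x + f x) w"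
  shows "fourier_coeff (w T) k - fourier_coeff (u T) k =
    of_real (exp (- (\<nu> * (of_int k)\<^sup>2 + (if \<bar>k\<bar> \<le> int M then c else 0)) * T)) *
    (fourier_coeff (w 0) k - fourier_coeff (u 0) k)"
proof (rule linear_ode_endpoint[OF T])
  show "continuous_on {0..T} (\<lambda>t. fourier_coeff (w t) k - fourier_coeff (u t) k)"
    by (intro continuous_on_diff heat_solution_fourier_coeff_continuous[OF u]
        heat_solution_fourier_coeff_continuous[OF w])
  fix t assume t: "t \<in> {0<..<T}"
  have int: "integrable period (u t)" "integrable period (w t)" "integrable period f"
    using u w f t by (auto simp: heat_solution_def intro!: L2per_integrable)
  have intP: "integrable period (\<lambda>x. of_real c * proj_low M (\<lambda>y. u t y - w t y) x)"
    using integrable_trig_sum by (simp add: proj_low_eq_trig_sum)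
  have intF: "integrable period (\<lambda>x. of_real c * proj_low M (\<lambda>y. u t y - w t y) x + f x)"
    using intP int(3) by simp
  have F: "fourier_coeff (\<lambda>x. of_real c * proj_low M (\<lambda>y. u t y - w t y) x + f x) k
      = (if \<bar>k\<bar> \<le> int M then of_real c * (fourier_coeff (u t) k - fourier_coeff (w t) k) else 0) + fourier_coeff f k"
    using int unfolding fourier_coeff_add[OF intP int(3)]
    by (auto simp: fourier_coeff_cmult proj_low_eq_trig_sum fourier_coeff_trig_sum fourier_coeff_diff)
  show "((\<lambda>t. fourier_coeff (w t) k - fourier_coeff (u t) k) has_vector_derivative
      - of_real (\<nu> * (of_int k)\<^sup>2 + (if \<bar>k\<bar> \<le> int M then c else 0)) *
      (fourier_coeff (w t) k - fourier_coeff (u t) k)) (at t)"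
    by (rule has_vector_derivative_eq_rhs[OF has_vector_derivative_diff[OF
          heat_solution_fourier_coeff_deriv[OF w t intF] heat_solution_fourier_coeff_deriv[OF u t int(3)]]])
       (simp only: F, simp add: algebra_simps)
qed

section \<open>Convergence of the back-and-forth iteration\<close>

text \<open>By completeness, \<open>g\<close> agrees almost everywhere with the trigonometric sum of its coefficients.\<close>
lemma L2per_norm_eq_of_band_limited:
  assumes g: "integrable period g" and A: "finite A" and zero: "\<And>k. k \<notin> A \<Longrightarrow> fourier_coeff g k = 0"
  shows "L2per_norm g = sqrt (2 * pi * (\<Sum>k\<in>A. (cmod (fourier_coeff g k))\<^sup>2))"
proof -
  let ?p = "trig_sum A (fourier_coeff g)"
  have "null_coeffs (\<lambda>x. g x - ?p x)"
    using zero by (auto simp: null_coeffs_def fourier_coeff_diff[OF g integrable_trig_sum]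
        fourier_coeff_trig_sum[OF A] g integrable_trig_sum)
  then have "AE x in period. g x = ?p x" by (auto dest: null_coeffs_imp_AE_zero)
  then have "(\<integral>x. (cmod (g x))\<^sup>2 \<partial>period) = (\<integral>x. (cmod (?p x))\<^sup>2 \<partial>period)"
    using g integrable_trig_sum[THEN borel_measurable_integrable]
    by (intro integral_cong_AE) auto
  then have "L2per_norm g = L2per_norm ?p" by (simp add: L2per_norm_def)
  then show ?thesis by (simp add: L2per_norm_trig_sum[OF A])
qed

lemma exp_mult_cancel:
  fixes X Y :: complex and a b :: real
  assumes "of_real (exp (- a)) * X = of_real (exp b) * Y"
  shows "X = of_real (exp (a + b)) * Y"
proof -
  have "X = of_real (exp a) * (of_real (exp (- a)) * X)"
    by (simp flip: mult.assoc of_real_mult exp_add)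
  then show ?thesis unfolding assms by (simp add: exp_add mult.assoc)
qed

theorem proposition3p2p1:
  fixes T \<nu> \<mu> \<mu>b :: real
    and f u0 v0 :: "real \<Rightarrow> complex"
    and K M :: nat
    and u :: "real \<Rightarrow> real \<Rightarrow> complex"
    and v vb :: "nat \<Rightarrow> real \<Rightarrow> real \<Rightarrow> complex"
  assumes T_pos: "T > 0"
    and \<nu>_pos: "\<nu> > 0"
    and f_L2: "f \<in> L2per"
    and \<mu>_nonneg: "\<mu> \<ge> 0"
    and \<mu>b_nonneg: "\<mu>b \<ge> 0"
    and nudging_active: "\<mu> > 0 \<or> \<mu>b > 0"
    and u0_poly: "trig_poly_degree K u0"
    and v0_poly: "trig_poly_degree K v0"
    and u_sol: "heat_solution T \<nu> (\<lambda>t. f) u"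
    and u_init: "AE x in lebesgue. u 0 x = u0 x"
    and v_sol: "\<And>n. n \<ge> 1 \<Longrightarrow>
      heat_solution T \<nu> (\<lambda>t x. of_real \<mu> * proj_low M (\<lambda>y. u t y - v n t y) x + f x) (v n)"
    and v_init: "\<And>n. n \<ge> 1 \<Longrightarrow> AE x in lebesgue. v n 0 x = vb (n - 1) 0 x"
    and vb_sol: "\<And>n. n \<ge> 1 \<Longrightarrow>
      heat_solution T \<nu> (\<lambda>t x. - of_real \<mu>b * proj_low M (\<lambda>y. u t y - vb n t y) x + f x) (vb n)"
    and vb_term: "\<And>n. n \<ge> 1 \<Longrightarrow> AE x in lebesgue. vb n T x = v n T x"
    and vb_start: "AE x in lebesgue. vb 0 0 x = v0 x"
  shows "(\<lambda>n. L2per_norm (\<lambda>x. v n 0 x - u0 x)) \<longlonglongrightarrow> L2per_norm (proj_high M (\<lambda>x. v0 x - u0 x))"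
proof -
  let ?B = "{- int K..int K}"
  obtain a where a: "u0 = trig_sum ?B a"
    using u0_poly by (auto simp: trig_poly_degree_def trig_sum_def fun_eq_iff)
  obtain b where b: "v0 = trig_sum ?B b"
    using v0_poly by (auto simp: trig_poly_degree_def trig_sum_def fun_eq_iff)
  \<comment> \<open>\<open>D\<close> is the initial error in each mode, \<open>q\<close> the factor gained in one forward and backward sweep.\<close>
  define D where "D k = (if k \<in> ?B then b k - a k else 0)" for k
  define q where "q k = exp (- (if \<bar>k\<bar> \<le> int M then \<mu> + \<mu>b else 0) * T)" for k
  define E where "E n k = fourier_coeff (v n 0) k - fourier_coeff u0 k" for n k
  have ends: "0 \<in> {0..T}" "T \<in> {0..T}" using T_pos by auto
  have int_u: "integrable period (u 0)" using u_sol ends by (auto simp: heat_solution_def intro!: L2per_integrable)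
  have int_u0: "integrable period u0" and int_v0: "integrable period v0"
    unfolding a b by (rule integrable_trig_sum)+
  have int_v: "integrable period (v n t)" "integrable period (vb n t)" if "n \<ge> 1" "t \<in> {0..T}" for n t
    using v_sol[OF that(1)] vb_sol[OF that(1)] that(2)
    by (auto simp: heat_solution_def intro!: L2per_integrable)
  have u0_coeff: "fourier_coeff (u 0) k = fourier_coeff u0 k" for k
    by (rule fourier_coeff_cong_AE[OF int_u int_u0 u_init])
  have D0: "E 1 k = D k" for k
  proof -
    have "AE x in lebesgue. v 1 0 x = v0 x"
      using v_init[of 1] vb_start by auto
    then have "fourier_coeff (v 1 0) k = fourier_coeff v0 k"
      using int_v(1)[of 1 0] ends by (intro fourier_coeff_cong_AE int_v0) auto
    then show ?thesis by (simp add: E_def D_def a b fourier_coeff_trig_sum)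
  qed
  have step: "E (Suc n) k = of_real (q k) * E n k" if n: "n \<ge> 1" for n k
  proof -
    define p where "p = \<nu> * (of_int k)\<^sup>2"
    define m where "m = (if \<bar>k\<bar> \<le> int M then \<mu> else 0)"
    define mb where "mb = (if \<bar>k\<bar> \<le> int M then \<mu>b else 0)"
    have fwd: "fourier_coeff (v n T) k - fourier_coeff (u T) k = of_real (exp (- (p + m) * T)) * E n k"
      using nudged_error_fourier_coeff[OF T_pos f_L2 u_sol v_sol[OF n]]
      by (simp add: E_def u0_coeff p_def m_def)
    have "heat_solution T \<nu> (\<lambda>t x. of_real (- \<mu>b) * proj_low M (\<lambda>y. u t y - vb n t y) x + f x) (vb n)"
      using vb_sol[OF n] by simp
    from nudged_error_fourier_coeff[OF T_pos f_L2 u_sol this, of k]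
    have bwd: "fourier_coeff (vb n T) k - fourier_coeff (u T) k
        = of_real (exp (- (p - mb) * T)) * (fourier_coeff (vb n 0) k - fourier_coeff u0 k)"
      by (simp add: u0_coeff p_def mb_def if_distrib cong: if_cong)
    have "fourier_coeff (vb n T) k = fourier_coeff (v n T) k"
      using int_v[OF n] ends by (intro fourier_coeff_cong_AE vb_term[OF n]) auto
    moreover have "fourier_coeff (v (Suc n) 0) k = fourier_coeff (vb n 0) k"
      using int_v[of "Suc n" 0] int_v[OF n] ends v_init[of "Suc n"]
      by (intro fourier_coeff_cong_AE) auto
    \<comment> \<open>Both sides are the error at time \<open>T\<close>, where the two sweeps meet.\<close>
    ultimately have "of_real (exp (- (p - mb) * T)) * E (Suc n) k = of_real (exp (- (p + m) * T)) * E n k"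
      using fwd bwd by (simp add: E_def)
    then have "E (Suc n) k = of_real (exp ((p - mb) * T + - (p + m) * T)) * E n k"
      by (intro exp_mult_cancel) (simp only: mult_minus_left)
    moreover have "(p - mb) * T + - (p + m) * T = - (m + mb) * T" by (simp add: algebra_simps)
    moreover have "q k = exp (- (m + mb) * T)" by (simp add: q_def m_def mb_def algebra_simps)
    ultimately show ?thesis by (simp only:)
  qed
  have E: "E (Suc n) k = of_real (q k ^ n) * D k" for n k
  proof (induction n)
    case 0
    show ?case using D0[of k] by simp
  next
    case (Suc n)
    then show ?case using step[of "Suc n" k] by simp
  qed
  have norm_v: "L2per_norm (\<lambda>x. v (Suc n) 0 x - u0 x) = sqrt (2 * pi * (\<Sum>k\<in>?B. (q k ^ n * cmod (D k))\<^sup>2))" for n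
  proof -
    have coeff: "fourier_coeff (\<lambda>x. v (Suc n) 0 x - u0 x) k = of_real (q k ^ n) * D k" for k
      using int_v(1)[of "Suc n" 0] ends int_u0 E[of n k] by (simp add: fourier_coeff_diff E_def)
    have "L2per_norm (\<lambda>x. v (Suc n) 0 x - u0 x)
        = sqrt (2 * pi * (\<Sum>k\<in>?B. (cmod (fourier_coeff (\<lambda>x. v (Suc n) 0 x - u0 x) k))\<^sup>2))"
      using int_v(1)[of "Suc n" 0] ends int_u0
      by (intro L2per_norm_eq_of_band_limited) (auto simp: coeff D_def)
    also have "\<dots> = sqrt (2 * pi * (\<Sum>k\<in>?B. (q k ^ n * cmod (D k))\<^sup>2))"
      unfolding coeff norm_mult norm_of_real by (simp add: q_def)
    finally show ?thesis .
  qed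
  have q_lim: "(\<lambda>n. q k ^ n) \<longlonglongrightarrow> (if \<bar>k\<bar> \<le> int M then 0 else 1)" for k
  proof (cases "\<bar>k\<bar> \<le> int M")
    case True
    have "\<mu> + \<mu>b > 0" using \<mu>_nonneg \<mu>b_nonneg nudging_active by auto
    then have "- (\<mu> + \<mu>b) * T < 0" using T_pos by (simp add: mult_less_0_iff)
    then have "exp (- (\<mu> + \<mu>b) * T) < 1" by simp
    then have "(\<lambda>n. exp (- (\<mu> + \<mu>b) * T) ^ n) \<longlonglongrightarrow> 0"
      by (intro LIMSEQ_realpow_zero) (auto simp del: exp_less_one_iff)
    then show ?thesis unfolding q_def if_P[OF True] .
  qed (simp add: q_def)
  have "(\<lambda>n. L2per_norm (\<lambda>x. v (Suc n) 0 x - u0 x)) \<longlonglongrightarrow>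
      sqrt (2 * pi * (\<Sum>k\<in>?B. ((if \<bar>k\<bar> \<le> int M then 0 else 1) * cmod (D k))\<^sup>2))"
    unfolding norm_v by (intro tendsto_intros q_lim)
  moreover have "L2per_norm (proj_high M (\<lambda>x. v0 x - u0 x))
      = sqrt (2 * pi * (\<Sum>k\<in>?B. ((if \<bar>k\<bar> \<le> int M then 0 else 1) * cmod (D k))\<^sup>2))"
  proof -
    let ?d = "\<lambda>x. v0 x - u0 x"
    have d: "?d = trig_sum ?B D"
      by (simp add: a b trig_sum_def D_def fun_eq_iff left_diff_distrib flip: sum_subtractf)
    have coeff_d: "fourier_coeff ?d = D"
      unfolding d by (auto simp: fun_eq_iff fourier_coeff_trig_sum D_def)
    have low: "proj_low M ?d x = trig_sum ?B (\<lambda>k. if \<bar>k\<bar> \<le> int M then D k else 0) x" for x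
      unfolding proj_low_eq_trig_sum coeff_d trig_sum_def
      by (rule sum.mono_neutral_cong) (auto simp: D_def)
    have "proj_high M ?d x = trig_sum ?B (\<lambda>k. if \<bar>k\<bar> \<le> int M then 0 else D k) x" for x
      unfolding proj_high_def low
      unfolding fun_cong[OF d] trig_sum_def by (subst sum_subtractf[symmetric], intro sum.cong) auto
    then have "proj_high M ?d = trig_sum ?B (\<lambda>k. if \<bar>k\<bar> \<le> int M then 0 else D k)"
      by (rule ext)
    moreover have "(\<Sum>k\<in>?B. (cmod (if \<bar>k\<bar> \<le> int M then 0 else D k))\<^sup>2)
        = (\<Sum>k\<in>?B. ((if \<bar>k\<bar> \<le> int M then 0 else 1) * cmod (D k))\<^sup>2)"
      by (intro sum.cong) auto
    ultimately show ?thesis by (simp only: L2per_norm_trig_sum[OF finite_atLeastAtMost_int])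
  qed
  ultimately have "(\<lambda>n. L2per_norm (\<lambda>x. v (Suc n) 0 x - u0 x)) \<longlonglongrightarrow> L2per_norm (proj_high M (\<lambda>x. v0 x - u0 x))"
    by (simp only:)
  then show ?thesis by (rule LIMSEQ_imp_Suc)
qed

end
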